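(* For the general body with rotor, $I_2>I_1>I_3$, to perform a dive with $m$ somersaults and $n$ twists in a total time $T_{tot}$ (with $\hat T_{tot}=lT_{tot}/I_1$) the conditions \[ \hat T_{tot}-2m\pi=2(\hat T_2-\phi_2)+(\hat P_3-\Phi_3)(n-\tfrac12) \] and \[ 2\hat T_1=2m\pi-2\phi_2-\Phi_3(n-\tfrac12)\ge0 \] need to be satisfied.
   Context: Rigid body with principal moments of inertia $I_i$, total angular momentum of magnitude $l>0$, $\delta=I_1/I_2-1<0$, $\gamma=I_1/I_3-1>0$. With rotor parameter $r$ ($r=h/l$ for internal angular momentum $(0,h,0)^t$ with rotor on; $r=0$ with rotor off) the equations of motion in scaled time $\tau=tl/I_1$ are $\phi'=1+\delta\sin^2\psi+(1+\delta)r\sec\theta\sin\psi$, $\theta'=-\delta\cos\theta\cos\psi\sin\psi-(1+\delta)r\cos\psi$, $\psi'=\gamma\sin\theta-\delta\sin\theta\sin^2\psi-(1+\delta)r\tan\theta\sin\psi$; $\phi,\theta,\psi$ are the somersault, tilt and twist angles, and the body-frame angular momentum is $\mathbf{L}=l(\cos\theta\cos\psi,-\cos\theta\sin\psi,\sin\theta)$. Hats denote scaled times, $\hat T=lT/I_1$. A dive consists of five consecutive stages, with continuous angles: Stage 1 (rotor off, scaled duration $\hat T_1$): pure somersault, $\theta=\psi=0$. Stage 2 (rotor on, scaled duration $\hat T_2$): $r=-\rho$ with constant $\rho>0$, started at $\theta=\psi=0$ and run until $\theta$ first reaches its maximal value $\theta_{max}\in(0,\pi/2)$ on the orbit, which happens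 at $\psi=\pi/2$; $\phi_2$ is the advance of $\phi$ in this stage. Stage 3 (rotor off): twisting motion starting at $\psi=\pi/2$, $\theta=\theta_{max}$, lasting $n-\frac12$ periods, where $\hat P_3$ is the scaled period (time for $\psi$ to advance by $2\pi$) and $\Phi_3$ the advance of $\phi$ in one period; the advance of $\phi$ in this stage is $\Phi_3(n-\frac12)$. Stage 4 (rotor on, scaled duration $\hat T_2$): $r=+\rho$ if $n$ is an integer, $r=-\rho$ if $n$ is a half-integer; mirror image of stage 2, returning the body to $\theta=0$, $\psi\in\pi\mathbb{Z}$, with the same advances of $\phi$ and $\psi$ as stage 2. Stage 5 (rotor off, scaled duration $\hat T_1$): pure somersault. Thus $\hat T_{tot}=2\hat T_1+2\hat T_2+\hat P_3(n-\frac12)$. With $\phi_1$, $\psi_1=0$ the advances of $\phi,\psi$ in stage 1 and $\psi_2=\pi/2$ that of $\psi$ in stage 2, the dive has $m$ somersaults and $n$ twists if $2\phi_1+2\phi_2+\Phi_3(n-\frac12)=2m\pi$ and $2\psi_1+2\psi_2+2\pi(n-\frac12)=2n\pi$, where $n\ge\frac12$ is an integer or half-integer. *)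

theory Defs
  imports "HOL-Analysis.Analysis"
begin

text \<open>
  The angles are functions of the scaled time \<open>\<tau> = t l / I\<^sub>1\<close>: somersault \<open>\<phi>\<close>, tilt \<open>\<theta>\<close>, twist \<open>\<psi>\<close>.
  The chart is restricted to \<open>\<bar>\<theta>\<bar> < \<pi>/2\<close>, where \<open>sec \<theta>\<close> and \<open>tan \<theta>\<close> are defined (in HOL they are
  junk at \<open>cos \<theta> = 0\<close>). Derivatives are taken within \<open>S\<close>, hence are one-sided at the ends of a
  stage; functions that satisfy the equations on adjacent closed intervals are thus continuous,
  while the velocities may jump when the rotor is switched.
\<close>

definition motion ::
  "real \<Rightarrow> real \<Rightarrow> real \<Rightarrow> real set \<Rightarrow> (real \<Rightarrow> real) \<Rightarrow> (real \<Rightarrow> real) \<Rightarrow> (real \<Rightarrow> real) \<Rightarrow> bool" where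
  "motion \<delta> \<gamma> r S \<phi> \<theta> \<psi> \<longleftrightarrow>
    (\<forall>t\<in>S. - pi/2 < \<theta> t \<and> \<theta> t < pi/2 \<and>
      (\<phi> has_real_derivative
        1 + \<delta> * (sin (\<psi> t))\<^sup>2 + (1 + \<delta>) * r * (1 / cos (\<theta> t)) * sin (\<psi> t)) (at t within S) \<and>
      (\<theta> has_real_derivative
        - \<delta> * cos (\<theta> t) * cos (\<psi> t) * sin (\<psi> t) - (1 + \<delta>) * r * cos (\<psi> t)) (at t within S) \<and>
      (\<psi> has_real_derivative
        \<gamma> * sin (\<theta> t) - \<delta> * sin (\<theta> t) * (sin (\<psi> t))\<^sup>2
          - (1 + \<delta>) * r * tan (\<theta> t) * sin (\<psi> t)) (at t within S))"

text \<open>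
  Stages 1 and 5. The angle \<open>c\<close> is a multiple of \<open>\<pi>\<close>: \<open>0\<close> in stage 1 and whatever twist has been
  accumulated in stage 5.
\<close>

definition pure_somersault ::
  "real \<Rightarrow> real \<Rightarrow> real \<Rightarrow> real \<Rightarrow> real \<Rightarrow> (real \<Rightarrow> real) \<Rightarrow> (real \<Rightarrow> real) \<Rightarrow> (real \<Rightarrow> real) \<Rightarrow> bool" where
  "pure_somersault \<delta> \<gamma> a b c \<phi> \<theta> \<psi> \<longleftrightarrow>
    (\<exists>k::int. c = of_int k * pi) \<and>
    motion \<delta> \<gamma> 0 {a..b} \<phi> \<theta> \<psi> \<and> (\<forall>t\<in>{a..b}. \<theta> t = 0 \<and> \<psi> t = c)"

text \<open>
  Stage 2, from time \<open>a\<close> to \<open>a + T2\<close>. The maximum of the tilt refers to the whole orbit through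
  \<open>\<theta> = \<psi> = 0\<close>, so the stage is an initial piece of a solution \<open>(\<Phi>, \<Theta>, \<Psi>)\<close> defined for all times.
\<close>

definition rotor_stage ::
  "real \<Rightarrow> real \<Rightarrow> real \<Rightarrow> real \<Rightarrow> real \<Rightarrow> real \<Rightarrow>
    (real \<Rightarrow> real) \<Rightarrow> (real \<Rightarrow> real) \<Rightarrow> (real \<Rightarrow> real) \<Rightarrow> bool" where
  "rotor_stage \<delta> \<gamma> \<rho> \<theta>max a T2 \<phi> \<theta> \<psi> \<longleftrightarrow>
    (\<exists>\<Phi> \<Theta> \<Psi>. motion \<delta> \<gamma> (- \<rho>) UNIV \<Phi> \<Theta> \<Psi> \<and> \<Theta> 0 = 0 \<and> \<Psi> 0 = 0 \<and>
      (\<forall>s. \<Theta> s \<le> \<theta>max) \<and> \<Theta> T2 = \<theta>max \<and> (\<forall>s\<in>{0..<T2}. \<Theta> s < \<theta>max) \<and> \<Psi> T2 = pi/2 \<and>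
      (\<forall>s\<in>{0..T2}. \<phi> (a + s) = \<Phi> s \<and> \<theta> (a + s) = \<Theta> s \<and> \<psi> (a + s) = \<Psi> s))"

text \<open>
  Stage 3, from time \<open>a\<close> to \<open>a + P3 (n - 1/2)\<close>. The period \<open>P3\<close> belongs to the full twisting orbit
  \<open>(\<Phi>, \<Theta>, \<Psi>)\<close>, since for \<open>n < 3/2\<close> the stage is shorter than one period. The last line records that
  over \<open>n - 1/2\<close> periods, which may be half-integral, the advances of the somersault and twist
  angles are the corresponding multiples of those of one period.
\<close>

definition twisting_stage ::
  "real \<Rightarrow> real \<Rightarrow> real \<Rightarrow> real \<Rightarrow> real \<Rightarrow> real \<Rightarrow> real \<Rightarrow>
    (real \<Rightarrow> real) \<Rightarrow> (real \<Rightarrow> real) \<Rightarrow> (real \<Rightarrow> real) \<Rightarrow> bool" where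
  "twisting_stage \<delta> \<gamma> \<theta>max n a P3 \<Phi>3 \<phi> \<theta> \<psi> \<longleftrightarrow>
    (\<exists>\<Phi> \<Theta> \<Psi>. motion \<delta> \<gamma> 0 UNIV \<Phi> \<Theta> \<Psi> \<and> \<Theta> 0 = \<theta>max \<and> \<Psi> 0 = pi/2 \<and>
      P3 > 0 \<and> \<Psi> P3 = \<Psi> 0 + 2 * pi \<and> (\<forall>s\<in>{0..<P3}. \<Psi> s < \<Psi> 0 + 2 * pi) \<and>
      \<Phi>3 = \<Phi> P3 - \<Phi> 0 \<and>
      (\<forall>s\<in>{0..P3 * (n - 1/2)}. \<phi> (a + s) = \<Phi> s \<and> \<theta> (a + s) = \<Theta> s \<and> \<psi> (a + s) = \<Psi> s)) \<and>
    (let b = a + P3 * (n - 1/2) in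
      \<phi> b - \<phi> a = \<Phi>3 * (n - 1/2) \<and> \<psi> b - \<psi> a = 2 * pi * (n - 1/2))"

text \<open>
  Stage 4 on \<open>[a, a + T2]\<close> is the mirror image of stage 2 on \<open>[b - T2, b]\<close>: the tilt is traversed
  backwards, and so are the other two angles up to a point reflection of their graphs. (The
  reflection \<open>\<psi> \<mapsto> -\<psi>\<close> or \<open>\<psi> \<mapsto> \<pi> - \<psi>\<close> combined with time reversal maps solutions for \<open>r\<close> to solutions
  for \<open>-r\<close> or \<open>r\<close>, respectively, whence the sign of the rotor parameter.)
\<close>

definition mirror_stage ::
  "real \<Rightarrow> real \<Rightarrow> real \<Rightarrow> real \<Rightarrow> real \<Rightarrow> real \<Rightarrow> real \<Rightarrow>
    (real \<Rightarrow> real) \<Rightarrow> (real \<Rightarrow> real) \<Rightarrow> (real \<Rightarrow> real) \<Rightarrow> bool" where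
  "mirror_stage \<delta> \<gamma> \<rho> n b a T2 \<phi> \<theta> \<psi> \<longleftrightarrow>
    motion \<delta> \<gamma> (if n \<in> \<int> then \<rho> else - \<rho>) {a..a + T2} \<phi> \<theta> \<psi> \<and>
    (\<forall>s\<in>{0..T2}. \<theta> (a + s) = \<theta> (b - s) \<and>
      \<phi> (a + s) - \<phi> a = \<phi> b - \<phi> (b - s) \<and> \<psi> (a + s) - \<psi> a = \<psi> b - \<psi> (b - s)) \<and>
    \<theta> (a + T2) = 0 \<and> (\<exists>k::int. \<psi> (a + T2) = of_int k * pi)"

text \<open>All durations are scaled; the last real argument \<open>T\<close> is the scaled total time.\<close>

definition dive ::
  "real \<Rightarrow> real \<Rightarrow> real \<Rightarrow> real \<Rightarrow> real \<Rightarrow> real \<Rightarrow> real \<Rightarrow> real \<Rightarrow> real \<Rightarrow> real \<Rightarrow>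
    (real \<Rightarrow> real) \<Rightarrow> (real \<Rightarrow> real) \<Rightarrow> (real \<Rightarrow> real) \<Rightarrow> bool" where
  "dive \<delta> \<gamma> \<rho> \<theta>max n T1 T2 P3 \<Phi>3 T \<phi> \<theta> \<psi> \<longleftrightarrow>
    n \<ge> 1/2 \<and> 2 * n \<in> \<int> \<and> T1 \<ge> 0 \<and> T2 > 0 \<and> 0 < \<theta>max \<and> \<theta>max < pi/2 \<and>
    (let t1 = T1; t2 = t1 + T2; t3 = t2 + P3 * (n - 1/2); t4 = t3 + T2 in
      T = t4 + T1 \<and>
      pure_somersault \<delta> \<gamma> 0 t1 0 \<phi> \<theta> \<psi> \<and>
      rotor_stage \<delta> \<gamma> \<rho> \<theta>max t1 T2 \<phi> \<theta> \<psi> \<and>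
      twisting_stage \<delta> \<gamma> \<theta>max n t2 P3 \<Phi>3 \<phi> \<theta> \<psi> \<and>
      mirror_stage \<delta> \<gamma> \<rho> n t2 t3 T2 \<phi> \<theta> \<psi> \<and>
      pure_somersault \<delta> \<gamma> t4 T (\<psi> t4) \<phi> \<theta> \<psi>)"

text \<open>
  The counts are expressed through the advances of stages 1 and 2 only; the lemma
  \<open>dive_total_advance\<close> below shows that the left-hand sides are the advances over the whole dive.
\<close>

definition somersaults_twists ::
  "real \<Rightarrow> real \<Rightarrow> real \<Rightarrow> real \<Rightarrow> real \<Rightarrow> (real \<Rightarrow> real) \<Rightarrow> (real \<Rightarrow> real) \<Rightarrow> bool" where
  "somersaults_twists m n T1 T2 \<Phi>3 \<phi> \<psi> \<longleftrightarrow>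
    (let \<phi>1 = \<phi> T1 - \<phi> 0; \<phi>2 = \<phi> (T1 + T2) - \<phi> T1;
         \<psi>1 = \<psi> T1 - \<psi> 0; \<psi>2 = \<psi> (T1 + T2) - \<psi> T1 in
      2 * \<phi>1 + 2 * \<phi>2 + \<Phi>3 * (n - 1/2) = 2 * m * pi \<and>
      2 * \<psi>1 + 2 * \<psi>2 + 2 * pi * (n - 1/2) = 2 * n * pi)"

lemma pure_somersault_advance:
  assumes "pure_somersault \<delta> \<gamma> a b c \<phi> \<theta> \<psi>" and "a \<le> b"
  shows "\<phi> b - \<phi> a = b - a" and "\<psi> b = \<psi> a"
proof -
  obtain k :: int where k: "c = of_int k * pi"
    using assms(1) by (auto simp: pure_somersault_def)
  have s: "sin c = 0"
    unfolding k by (simp add: sin_zero_iff_int2)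
  have "(\<phi> has_vector_derivative 1) (at t within {a..b})" if "t \<in> {a..b}" for t
    using assms(1) that s
    by (force simp: pure_somersault_def motion_def has_real_derivative_iff_has_vector_derivative)
  then have "((\<lambda>_. 1) has_integral (\<phi> b - \<phi> a)) {a..b}"
    by (intro fundamental_theorem_of_calculus assms(2))
  moreover have "((\<lambda>_. 1) has_integral (b - a)) {a..b}"
    using has_integral_const_real[of "1::real" a b] assms(2) by simp
  ultimately show "\<phi> b - \<phi> a = b - a"
    by (rule has_integral_unique)
  show "\<psi> b = \<psi> a"
    using assms by (simp add: pure_somersault_def)
qed

lemma dive_total_advance:
  assumes "dive \<delta> \<gamma> \<rho> \<theta>max n T1 T2 P3 \<Phi>3 T \<phi> \<theta> \<psi>"
  defines "\<phi>1 \<equiv> \<phi> T1 - \<phi> 0" and "\<phi>2 \<equiv> \<phi> (T1 + T2) - \<phi> T1"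
    and "\<psi>1 \<equiv> \<psi> T1 - \<psi> 0" and "\<psi>2 \<equiv> \<psi> (T1 + T2) - \<psi> T1"
  shows "\<phi> T - \<phi> 0 = 2 * \<phi>1 + 2 * \<phi>2 + \<Phi>3 * (n - 1/2)"
    and "\<psi> T - \<psi> 0 = 2 * \<psi>1 + 2 * \<psi>2 + 2 * pi * (n - 1/2)"
proof -
  define t2 where "t2 = T1 + T2"
  define t3 where "t3 = t2 + P3 * (n - 1/2)"
  have T: "T = t3 + T2 + T1" and "T1 \<ge> 0" "T2 > 0"
    and s1: "pure_somersault \<delta> \<gamma> 0 T1 0 \<phi> \<theta> \<psi>"
    and s3: "twisting_stage \<delta> \<gamma> \<theta>max n t2 P3 \<Phi>3 \<phi> \<theta> \<psi>"
    and s4: "mirror_stage \<delta> \<gamma> \<rho> n t2 t3 T2 \<phi> \<theta> \<psi>"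
    and s5: "pure_somersault \<delta> \<gamma> (t3 + T2) T (\<psi> (t3 + T2)) \<phi> \<theta> \<psi>"
    using assms(1) unfolding dive_def Let_def t2_def t3_def by blast+
  have a1: "\<phi>1 = T1" "\<psi>1 = 0"
    using pure_somersault_advance[OF s1 \<open>T1 \<ge> 0\<close>] by (simp_all add: \<phi>1_def \<psi>1_def)
  have a5: "\<phi> T - \<phi> (t3 + T2) = T1" "\<psi> T = \<psi> (t3 + T2)"
    using pure_somersault_advance[OF s5] \<open>T1 \<ge> 0\<close> by (simp_all add: T)
  have a3: "\<phi> t3 - \<phi> t2 = \<Phi>3 * (n - 1/2)" "\<psi> t3 - \<psi> t2 = 2 * pi * (n - 1/2)"
    using s3 by (simp_all add: twisting_stage_def Let_def t3_def)
  have "\<forall>s\<in>{0..T2}. \<phi> (t3 + s) - \<phi> t3 = \<phi> t2 - \<phi> (t2 - s) \<and> \<psi> (t3 + s) - \<psi> t3 = \<psi> t2 - \<psi> (t2 - s)"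
    using s4 by (auto simp: mirror_stage_def)
  from bspec[OF this, of T2] \<open>T2 > 0\<close>
  have a4: "\<phi> (t3 + T2) - \<phi> t3 = \<phi>2" "\<psi> (t3 + T2) - \<psi> t3 = \<psi>2"
    by (simp_all add: \<phi>2_def \<psi>2_def t2_def)
  show "\<phi> T - \<phi> 0 = 2 * \<phi>1 + 2 * \<phi>2 + \<Phi>3 * (n - 1/2)"
    using a1 a3 a4 a5 unfolding \<phi>1_def \<phi>2_def t2_def by (simp add: algebra_simps)
  show "\<psi> T - \<psi> 0 = 2 * \<psi>1 + 2 * \<psi>2 + 2 * pi * (n - 1/2)"
    using a1 a3 a4 a5 unfolding \<psi>1_def \<psi>2_def t2_def by (simp add: algebra_simps)
qed

end

theory Submission
  imports Defs
begin

text \<open>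
  Both conditions balance the time budget against the somersault budget. While the rotor is off and
  \<open>\<theta> = \<psi> = 0\<close>, the somersault angle runs at unit speed in scaled time, so a pure somersault of
  duration \<open>T1\<close> contributes exactly \<open>T1\<close> to the somersault angle
  (\<open>pure_somersault_advance\<close>). The somersault count then determines \<open>T1\<close> from the advances of the
  other stages, and the inequality says that this duration is nonnegative. Substituting \<open>T1\<close> into
  the total time, the pure somersaults cancel and only the lag \<open>T2 - \<phi>2\<close> or \<open>P3 - \<Phi>3\<close> of
  the angle behind the scaled time survives in each of the remaining stages.
\<close>

theorem theorem13:
  fixes I1 I2 I3 l \<delta> \<gamma> \<rho> \<theta>max m n T1 T2 P3 \<phi>2 \<Phi>3 Ttot :: real
    and \<phi> \<theta> \<psi> :: "real \<Rightarrow> real"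
  assumes "I2 > I1" and "I1 > I3" and "I3 > 0"
    and "l > 0"
    and "\<delta> = I1 / I2 - 1" and "\<gamma> = I1 / I3 - 1"
    and "\<rho> > 0"
    and "dive \<delta> \<gamma> \<rho> \<theta>max n T1 T2 P3 \<Phi>3 (l * Ttot / I1) \<phi> \<theta> \<psi>"
    and "\<phi>2 = \<phi> (T1 + T2) - \<phi> T1"
    and "somersaults_twists m n T1 T2 \<Phi>3 \<phi> \<psi>"
  shows "l * Ttot / I1 - 2 * m * pi = 2 * (T2 - \<phi>2) + (P3 - \<Phi>3) * (n - 1/2) \<and>
    2 * T1 = 2 * m * pi - 2 * \<phi>2 - \<Phi>3 * (n - 1/2) \<and>
    2 * m * pi - 2 * \<phi>2 - \<Phi>3 * (n - 1/2) \<ge> 0"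
proof -
  have total: "l * Ttot / I1 = 2 * T1 + 2 * T2 + P3 * (n - 1/2)"
    and "T1 \<ge> 0" and stage1: "pure_somersault \<delta> \<gamma> 0 T1 0 \<phi> \<theta> \<psi>"
    using assms(8) unfolding dive_def Let_def by linarith+
  have "\<phi> T1 - \<phi> 0 = T1"
    using pure_somersault_advance(1)[OF stage1 \<open>T1 \<ge> 0\<close>] by simp
  with assms(9,10) have count: "2 * T1 + 2 * \<phi>2 + \<Phi>3 * (n - 1/2) = 2 * m * pi"
    by (simp add: somersaults_twists_def Let_def)
  have "l * Ttot / I1 - 2 * m * pi = 2 * (T2 - \<phi>2) + (P3 - \<Phi>3) * (n - 1/2)"
    using total count by (simp add: left_diff_distrib)
  with count \<open>T1 \<ge> 0\<close> show ?thesis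
    by linarith
qed

end
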